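(* Let $q\in\mathbb{R}[x_1,\ldots,x_m]$ be a homogeneous polynomial of degree $2d$ that is a sum of squares, let $m_d(x)$ be the column vector of all $N=\binom{m+d-1}{d}$ monomials of degree $d$ in $x_1,\ldots,x_m$, and let $Q$ be an $N\times N$ real symmetric positive semidefinite matrix such that $q(x)=m_d(x)^TQ\,m_d(x)$. Then $q$ has a hyperbolic certificate of nonnegativity given by $$q(x)=\phi_{p,e}(F(x),g(x))[U],$$ where $p(X)=\det(X)$ on the space $\mathcal{S}^{N+1}$ of $(N+1)\times(N+1)$ real symmetric matrices, $e=I$ is the identity matrix, $$U=\begin{bmatrix}0&0\\0&Q\end{bmatrix},\qquad F(x)=\begin{bmatrix}0&m_d(x)^T\\ m_d(x)&0\end{bmatrix},$$ and $g(x)=e_2$ is the constant map equal to the second standard basis vector of $\mathbb{R}^{N+1}$.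
   Context: A homogeneous polynomial $p$ of degree $D$ on a finite-dimensional real vector space $V$ (here $V=\mathcal{S}^{N+1}$, $D=N+1$) is hyperbolic with respect to $e\in V$ if $p(e)>0$ and for every $X\in V$ the polynomial $t\mapsto p(X+te)$ has only real zeros. The hyperbolicity cone $\Lambda_+(p,e)$ is the set of $X$ such that all zeros of $t\mapsto p(te-X)$ are nonnegative. For $X,U\in V$ put $p_X(t)=p(X+te)$ and $D_Up_X(t)=(D_Up)(X+te)$, where $D_U$ denotes the directional derivative in direction $U$. The parameterized Hermite matrix $H_{p,e}(X)[U]$ is the $D\times D$ Hankel matrix $[h_{i+j-1}]_{i,j=1}^D$, where $\frac{D_Up_X(t)}{p_X(t)}=\sum_{k\ge1}h_kt^{-k}$. For $y\in\mathbb{R}^D$ define $\phi_{p,e}(X,y)[U]=y^TH_{p,e}(X)[U]\,y$. A polynomial $q$ in $m$ variables has a hyperbolic certificate of nonnegativity with respect to $(p,e)$ if there exist $U\in\Lambda_+(p,e)$ and polynomial maps $f:\mathbb{R}^m\to V$, $g:\mathbb{R}^m\to\mathbb{R}^D$ such that $q(z)=\phi_{p,e}(f(z),g(z))[U]$ for all $z\in\mathbb{R}^m$. *)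

theory Defs
  imports "Jordan_Normal_Form.Determinant" "HOL-Library.Poly_Mapping"
begin

section \<open>Multivariate real polynomials\<close>

text \<open>
  A polynomial with variables in \<^typ>\<open>'v\<close> is a finitely supported map from exponent vectors to
  coefficients; its ring operations are those of the instance in \<^theory>\<open>HOL-Library.Poly_Mapping\<close>.
\<close>

type_synonym 'v mono = "'v \<Rightarrow>\<^sub>0 nat"
type_synonym 'v rpoly = "('v \<Rightarrow>\<^sub>0 nat) \<Rightarrow>\<^sub>0 real"

definition mono_degree :: "'v mono \<Rightarrow> nat" where
  "mono_degree \<alpha> = (\<Sum>v\<in>Poly_Mapping.keys \<alpha>. Poly_Mapping.lookup \<alpha> v)"

definition mono_eval :: "'v mono \<Rightarrow> ('v \<Rightarrow> real) \<Rightarrow> real" where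
  "mono_eval \<alpha> x = (\<Prod>v\<in>Poly_Mapping.keys \<alpha>. x v ^ Poly_Mapping.lookup \<alpha> v)"

definition rpoly_eval :: "'v rpoly \<Rightarrow> ('v \<Rightarrow> real) \<Rightarrow> real" where
  "rpoly_eval P x = (\<Sum>\<alpha>\<in>Poly_Mapping.keys P. Poly_Mapping.lookup P \<alpha> * mono_eval \<alpha> x)"

definition rpolys_in :: "'v set \<Rightarrow> 'v rpoly set" where
  "rpolys_in S = {P. \<forall>\<alpha>\<in>Poly_Mapping.keys P. Poly_Mapping.keys \<alpha> \<subseteq> S}"

text \<open>As usual, the zero polynomial is homogeneous of every degree.\<close>

definition homogeneous :: "nat \<Rightarrow> 'v rpoly \<Rightarrow> bool" where
  "homogeneous k P \<longleftrightarrow> (\<forall>\<alpha>\<in>Poly_Mapping.keys P. mono_degree \<alpha> = k)"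

text \<open>The variables \<open>x\<^sub>1, \<dots>, x\<^sub>m\<close> are indexed by \<open>0, \<dots>, m - 1\<close>.\<close>

definition sum_of_squares :: "nat \<Rightarrow> nat rpoly \<Rightarrow> bool" where
  "sum_of_squares m q \<longleftrightarrow>
     (\<exists>gs. set gs \<subseteq> rpolys_in {..<m} \<and> q = sum_list (map (\<lambda>g. g ^ 2) gs))"

definition monomials :: "nat \<Rightarrow> nat \<Rightarrow> nat mono set" where
  "monomials m d = {\<alpha>. Poly_Mapping.keys \<alpha> \<subseteq> {..<m} \<and> mono_degree \<alpha> = d}"

text \<open>
  The vector of the monomials \<open>\<mu> 0, \<dots>, \<mu> (N - 1)\<close> evaluated at \<open>x\<close>.
\<close>

definition monomial_vec :: "nat \<Rightarrow> (nat \<Rightarrow> nat mono) \<Rightarrow> real vec \<Rightarrow> real vec" where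
  "monomial_vec N \<mu> x = vec N (\<lambda>i. mono_eval (\<mu> i) (\<lambda>v. x $ v))"

definition polynomial_fun :: "nat \<Rightarrow> (real vec \<Rightarrow> real) \<Rightarrow> bool" where
  "polynomial_fun m f \<longleftrightarrow>
     (\<exists>P\<in>rpolys_in {..<m}. \<forall>z\<in>carrier_vec m. f z = rpoly_eval P (\<lambda>v. z $ v))"


section \<open>Symmetric matrices\<close>

definition sym_mats :: "nat \<Rightarrow> real mat set" where
  "sym_mats n = {A \<in> carrier_mat n n. A\<^sup>T = A}"

definition psd :: "nat \<Rightarrow> real mat \<Rightarrow> bool" where
  "psd n A \<longleftrightarrow> A \<in> sym_mats n \<and> (\<forall>v\<in>carrier_vec n. v \<bullet> (A *\<^sub>v v) \<ge> 0)"

definition polynomial_map_vec :: "nat \<Rightarrow> nat \<Rightarrow> (real vec \<Rightarrow> real vec) \<Rightarrow> bool" where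
  "polynomial_map_vec m D g \<longleftrightarrow>
     (\<forall>z\<in>carrier_vec m. g z \<in> carrier_vec D) \<and> (\<forall>i<D. polynomial_fun m (\<lambda>z. g z $ i))"

definition polynomial_map_sym :: "nat \<Rightarrow> nat \<Rightarrow> (real vec \<Rightarrow> real mat) \<Rightarrow> bool" where
  "polynomial_map_sym m n f \<longleftrightarrow>
     (\<forall>z\<in>carrier_vec m. f z \<in> sym_mats n) \<and>
     (\<forall>i<n. \<forall>j<n. polynomial_fun m (\<lambda>z. f z $$ (i, j)))"


section \<open>Hyperbolic polynomials on the space of symmetric matrices\<close>

text \<open>
  The ambient space is \<^term>\<open>sym_mats n\<close>. A polynomial on this subspace is a function on it that is
  given by a polynomial in the matrix entries.
\<close>

definition homogeneous_polynomial_on_sym :: "nat \<Rightarrow> nat \<Rightarrow> (real mat \<Rightarrow> real) \<Rightarrow> bool" where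
  "homogeneous_polynomial_on_sym n D p \<longleftrightarrow>
     (\<exists>P\<in>rpolys_in ({..<n} \<times> {..<n}). homogeneous D P \<and>
        (\<forall>X\<in>sym_mats n. p X = rpoly_eval P (\<lambda>ij. X $$ ij)))"

text \<open>
  The real polynomial representing \<open>f\<close> is unique, and it is its complex zeros that have to be real.
\<close>

definition real_rooted :: "(real \<Rightarrow> real) \<Rightarrow> bool" where
  "real_rooted f \<longleftrightarrow>
     (\<exists>P :: real poly. (\<forall>t. f t = poly P t) \<and>
        (\<forall>z :: complex. poly (map_poly complex_of_real P) z = 0 \<longrightarrow> z \<in> \<real>))"

definition hyperbolic :: "nat \<Rightarrow> nat \<Rightarrow> (real mat \<Rightarrow> real) \<Rightarrow> real mat \<Rightarrow> bool" where
  "hyperbolic n D p e \<longleftrightarrow>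
     homogeneous_polynomial_on_sym n D p \<and> e \<in> sym_mats n \<and> p e > 0 \<and>
     (\<forall>X\<in>sym_mats n. real_rooted (\<lambda>t. p (X + t \<cdot>\<^sub>m e)))"

text \<open>
  For hyperbolic \<open>p\<close> all zeros of \<open>t \<mapsto> p (t e - X)\<close> are real, so it suffices to let \<open>t\<close> range over
  the reals.
\<close>

definition hyperbolicity_cone :: "nat \<Rightarrow> (real mat \<Rightarrow> real) \<Rightarrow> real mat \<Rightarrow> real mat set" where
  "hyperbolicity_cone n p e = {X \<in> sym_mats n. \<forall>t::real. p (t \<cdot>\<^sub>m e - X) = 0 \<longrightarrow> t \<ge> 0}"

definition dir_deriv :: "(real mat \<Rightarrow> real) \<Rightarrow> real mat \<Rightarrow> real mat \<Rightarrow> real" where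
  "dir_deriv p U Y = (THE c. ((\<lambda>s. p (Y + s \<cdot>\<^sub>m U)) has_real_derivative c) (at 0))"

text \<open>
  The expansion \<open>D\<^sub>U p\<^sub>X(t) / p\<^sub>X(t) = \<Sum>k\<ge>1. h\<^sub>k t\<^sup>-\<^sup>k\<close> is the one at infinity, convergent for all
  large \<open>t\<close>. Setting \<open>h 0 = 0\<close> makes the coefficient sequence unique.
\<close>

definition hermite_coeffs ::
  "(real mat \<Rightarrow> real) \<Rightarrow> real mat \<Rightarrow> real mat \<Rightarrow> real mat \<Rightarrow> nat \<Rightarrow> real" where
  "hermite_coeffs p e X U =
     (THE h. h 0 = 0 \<and>
        (\<forall>\<^sub>F t in at_top.
           (\<lambda>k. h k / t ^ k) sums (dir_deriv p U (X + t \<cdot>\<^sub>m e) / p (X + t \<cdot>\<^sub>m e))))"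

text \<open>
  With indices \<open>i, j\<close> starting at 0 instead of 1, the entry \<open>h\<^sub>i\<^sub>+\<^sub>j\<^sub>-\<^sub>1\<close> becomes \<open>h\<^sub>i\<^sub>+\<^sub>j\<^sub>+\<^sub>1\<close>.
\<close>

definition hermite_mat ::
  "nat \<Rightarrow> (real mat \<Rightarrow> real) \<Rightarrow> real mat \<Rightarrow> real mat \<Rightarrow> real mat \<Rightarrow> real mat" where
  "hermite_mat D p e X U = mat D D (\<lambda>(i, j). hermite_coeffs p e X U (i + j + 1))"

definition hermite_form ::
  "nat \<Rightarrow> (real mat \<Rightarrow> real) \<Rightarrow> real mat \<Rightarrow> real mat \<Rightarrow> real vec \<Rightarrow> real mat \<Rightarrow> real" where
  "hermite_form D p e X y U = y \<bullet> (hermite_mat D p e X U *\<^sub>v y)"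

definition hyperbolic_certificate ::
  "nat \<Rightarrow> nat \<Rightarrow> (real mat \<Rightarrow> real) \<Rightarrow> real mat \<Rightarrow> nat \<Rightarrow> nat rpoly \<Rightarrow>
   real mat \<Rightarrow> (real vec \<Rightarrow> real mat) \<Rightarrow> (real vec \<Rightarrow> real vec) \<Rightarrow> bool" where
  "hyperbolic_certificate n D p e m q U f g \<longleftrightarrow>
     U \<in> hyperbolicity_cone n p e \<and>
     polynomial_map_sym m n f \<and> polynomial_map_vec m D g \<and>
     (\<forall>z\<in>carrier_vec m. rpoly_eval q (\<lambda>v. z $ v) = hermite_form D p e (f z) (g z) U)"

definition has_hyperbolic_certificate ::
  "nat \<Rightarrow> nat \<Rightarrow> (real mat \<Rightarrow> real) \<Rightarrow> real mat \<Rightarrow> nat \<Rightarrow> nat rpoly \<Rightarrow> bool" where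
  "has_hyperbolic_certificate n D p e m q \<longleftrightarrow>
     (\<exists>U f g. hyperbolic_certificate n D p e m q U f g)"


section \<open>The data of the certificate\<close>

definition cert_U :: "nat \<Rightarrow> real mat \<Rightarrow> real mat" where
  "cert_U N Q = four_block_mat (0\<^sub>m 1 1) (0\<^sub>m 1 N) (0\<^sub>m N 1) Q"

definition cert_F :: "nat \<Rightarrow> (nat \<Rightarrow> nat mono) \<Rightarrow> real vec \<Rightarrow> real mat" where
  "cert_F N \<mu> x =
     four_block_mat (0\<^sub>m 1 1) (mat_of_rows N [monomial_vec N \<mu> x])
                    (mat_of_cols N [monomial_vec N \<mu> x]) (0\<^sub>m N N)"

end

theory Submission
  imports Defs "Jordan_Normal_Form.Char_Poly"
begin

text \<open>
  For a square matrix \<open>X\<close> and large \<open>t\<close>, Jacobi's formula and the Neumann series of the resolvent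
  give
  \<open>D\<^sub>U det (X + t I) / det (X + t I) = tr (U (X + t I)\<^sup>-\<^sup>1) = \<Sum>k\<ge>0. (-1)\<^sup>k tr (X\<^sup>k U) t\<^sup>-\<^sup>k\<^sup>-\<^sup>1\<close>.
  Since the coefficients of an expansion at infinity are unique, the Hermite coefficient with
  index \<open>k + 1\<close> is \<open>(-1)\<^sup>k tr (X\<^sup>k U)\<close> (lemma \<open>hermite_coeffs_det\<close>). The second unit vector picks the
  entry \<open>h\<^sub>3 = tr (X\<^sup>2 U)\<close> of the Hermite matrix. For \<open>X = F(x)\<close> with monomial vector \<open>w\<close>, the square is
  block diagonal with blocks \<open>w\<^sup>T w\<close> and \<open>w w\<^sup>T\<close>, so that \<open>h\<^sub>3 = tr (w w\<^sup>T Q) = w\<^sup>T Q w = q(x)\<close>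
  (lemma \<open>trace_cert\<close>).

  Hyperbolicity of the determinant is the reality of the eigenvalues of a real symmetric matrix,
  and \<open>U\<close> lies in the hyperbolicity cone because it is positive semidefinite along with \<open>Q\<close>.
\<close>

section \<open>The determinant as a homogeneous polynomial in the matrix entries\<close>

lemma mono_eval_superset:
  assumes "finite S" "Poly_Mapping.keys \<alpha> \<subseteq> S"
  shows "mono_eval \<alpha> x = (\<Prod>v\<in>S. x v ^ Poly_Mapping.lookup \<alpha> v)"
  unfolding mono_eval_def using assms
  by (intro prod.mono_neutral_left) (auto simp: in_keys_iff)

lemma mono_degree_superset:
  assumes "finite S" "Poly_Mapping.keys \<alpha> \<subseteq> S"
  shows "mono_degree \<alpha> = (\<Sum>v\<in>S. Poly_Mapping.lookup \<alpha> v)"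
  unfolding mono_degree_def using assms
  by (intro sum.mono_neutral_left) (auto simp: in_keys_iff)

lemma rpoly_eval_superset:
  assumes "finite S" "Poly_Mapping.keys P \<subseteq> S"
  shows "rpoly_eval P x = (\<Sum>\<alpha>\<in>S. Poly_Mapping.lookup P \<alpha> * mono_eval \<alpha> x)"
  unfolding rpoly_eval_def using assms
  by (intro sum.mono_neutral_left) (auto simp: in_keys_iff)

lemma mono_eval_add: "mono_eval (\<alpha> + \<beta>) x = mono_eval \<alpha> x * mono_eval \<beta> x"
proof -
  let ?S = "Poly_Mapping.keys \<alpha> \<union> Poly_Mapping.keys \<beta>"
  have "Poly_Mapping.keys (\<alpha> + \<beta>) \<subseteq> ?S" by (rule keys_add)
  then show ?thesis
    by (simp add: mono_eval_superset[of ?S] lookup_add power_add prod.distrib)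
qed

lemma mono_degree_add: "mono_degree (\<alpha> + \<beta>) = mono_degree \<alpha> + mono_degree \<beta>"
proof -
  let ?S = "Poly_Mapping.keys \<alpha> \<union> Poly_Mapping.keys \<beta>"
  have "Poly_Mapping.keys (\<alpha> + \<beta>) \<subseteq> ?S" by (rule keys_add)
  then show ?thesis
    by (simp add: mono_degree_superset[of ?S] lookup_add sum.distrib)
qed

lemma rpoly_eval_add: "rpoly_eval (P + R) x = rpoly_eval P x + rpoly_eval R x"
proof -
  let ?S = "Poly_Mapping.keys P \<union> Poly_Mapping.keys R"
  have "Poly_Mapping.keys (P + R) \<subseteq> ?S" by (rule keys_add)
  then show ?thesis
    by (simp add: rpoly_eval_superset[of ?S] lookup_add distrib_right sum.distrib)
qed

lemma mono_eval_0 [simp]: "mono_eval 0 x = 1"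
  by (simp add: mono_eval_def)

lemma mono_degree_0 [simp]: "mono_degree 0 = 0"
  by (simp add: mono_degree_def)

lemma rpoly_eval_0 [simp]: "rpoly_eval 0 x = 0"
  by (simp add: rpoly_eval_def)

lemma rpoly_eval_single [simp]: "rpoly_eval (Poly_Mapping.single \<alpha> c) x = c * mono_eval \<alpha> x"
  by (simp add: rpoly_eval_def)

lemma mono_eval_sum_var:
  "mono_eval (\<Sum>i\<in>I. Poly_Mapping.single (f i) 1) x = (\<Prod>i\<in>I. x (f i))"
  by (induction I rule: infinite_finite_induct) (simp_all add: mono_eval_add, simp add: mono_eval_def)

lemma mono_degree_sum_var:
  "mono_degree (\<Sum>i\<in>I. Poly_Mapping.single (f i) 1) = card I"
  by (induction I rule: infinite_finite_induct) (simp_all add: mono_degree_add, simp add: mono_degree_def)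

lemma keys_sum_var_subset:
  "Poly_Mapping.keys (\<Sum>i\<in>I. Poly_Mapping.single (f i) (1::nat)) \<subseteq> f ` I"
  using keys_sum[of "\<lambda>i. Poly_Mapping.single (f i) (1::nat)" I] by auto

lemma rpoly_eval_sum: "rpoly_eval (\<Sum>i\<in>I. P i) x = (\<Sum>i\<in>I. rpoly_eval (P i) x)"
  by (induction I rule: infinite_finite_induct) (simp_all add: rpoly_eval_add)

lemma det_homogeneous_polynomial_on_sym: "homogeneous_polynomial_on_sym n n det"
proof -
  \<comment> \<open>the Leibniz formula, read as a polynomial in the entries\<close>
  define \<alpha> :: "(nat \<Rightarrow> nat) \<Rightarrow> (nat \<times> nat) mono"
    where "\<alpha> p = (\<Sum>i\<in>{0..<n}. Poly_Mapping.single (i, p i) 1)" for p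
  define P :: "(nat \<times> nat) rpoly"
    where "P = (\<Sum>p\<in>{p. p permutes {0..<n}}. Poly_Mapping.single (\<alpha> p) (signof p))"
  have keys_P: "\<exists>p. p permutes {0..<n} \<and> \<beta> = \<alpha> p" if "\<beta> \<in> Poly_Mapping.keys P" for \<beta>
    using that keys_sum[of "\<lambda>p. Poly_Mapping.single (\<alpha> p) (signof p :: real)" "{p. p permutes {0..<n}}"]
    unfolding P_def by (auto split: if_splits)
  have "P \<in> rpolys_in ({..<n} \<times> {..<n})"
  proof -
    have "Poly_Mapping.keys (\<alpha> p) \<subseteq> {..<n} \<times> {..<n}" if "p permutes {0..<n}" for p
      using keys_sum_var_subset[of "\<lambda>i. (i, p i)" "{0..<n}"] permutes_in_image[OF that]
      unfolding \<alpha>_def by fastforce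
    then show ?thesis
      using keys_P unfolding rpolys_in_def by blast
  qed
  moreover have "homogeneous n P"
  proof -
    have "mono_degree (\<alpha> p) = n" for p
      unfolding \<alpha>_def by (simp only: mono_degree_sum_var card_atLeastLessThan diff_zero)
    then show ?thesis
      using keys_P unfolding homogeneous_def by metis
  qed
  moreover have "det X = rpoly_eval P (\<lambda>ij. X $$ ij)" if "X \<in> sym_mats n" for X
    using that unfolding P_def \<alpha>_def
    by (simp add: sym_mats_def det_def'[of X n] rpoly_eval_sum mono_eval_sum_var del: One_nat_def)
  ultimately show ?thesis
    unfolding homogeneous_polynomial_on_sym_def by blast
qed


section \<open>Hyperbolicity of the determinant\<close>

lemma symmetric_eigenvalue_real:
  assumes A: "A \<in> sym_mats n"
    and ev: "eigenvalue (map_mat complex_of_real A) z"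
  shows "z \<in> \<real>"
proof -
  let ?B = "map_mat complex_of_real A"
  have dA: "A \<in> carrier_mat n n" and tA: "A\<^sup>T = A" using A by (auto simp: sym_mats_def)
  have B: "?B \<in> carrier_mat n n" using dA by simp
  have tB: "?B\<^sup>T = ?B" using tA by (metis map_mat_transpose)
  obtain v where v: "v \<in> carrier_vec n" "v \<noteq> 0\<^sub>v n" and Bv: "?B *\<^sub>v v = z \<cdot>\<^sub>v v"
    using ev dA unfolding eigenvalue_def eigenvector_def by auto
  have cv: "conjugate v \<in> carrier_vec n" using v by simp
  have "?B *\<^sub>v conjugate v = conjugate (?B *\<^sub>v v)"
    using dA v by (intro eq_vecI) (auto simp: scalar_prod_def)
  then have Bcv: "?B *\<^sub>v conjugate v = conjugate z \<cdot>\<^sub>v conjugate v"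
    by (simp add: Bv conjugate_smult_vec)
  \<comment> \<open>symmetry moves the matrix across the Hermitian product, which turns \<open>z\<close> into its conjugate\<close>
  have "z * (v \<bullet>c v) = (?B *\<^sub>v v) \<bullet> conjugate v"
    using v cv Bv by simp
  also have "\<dots> = v \<bullet> (?B *\<^sub>v conjugate v)"
    using transpose_vec_mult_scalar[OF B cv v(1)] tB by simp
  also have "\<dots> = cnj z * (v \<bullet>c v)"
    using v cv Bcv by simp
  finally have "z = cnj z"
    using v by simp
  then show ?thesis
    by (metis Reals_cnj_iff)
qed

lemma det_real_rooted:
  assumes X: "X \<in> sym_mats n"
  shows "real_rooted (\<lambda>t. det (X + t \<cdot>\<^sub>m 1\<^sub>m n))"
proof -
  have dX: "X \<in> carrier_mat n n" and tX: "X\<^sup>T = X" using X by (auto simp: sym_mats_def)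
  have sX: "- X \<in> sym_mats n"
    using dX tX by (auto simp: sym_mats_def transpose_uminus)
  have dN: "- X \<in> carrier_mat n n" using dX by simp
  have "det (X + t \<cdot>\<^sub>m 1\<^sub>m n) = poly (char_poly (- X)) t" for t
  proof -
    have "X + t \<cdot>\<^sub>m 1\<^sub>m n = - char_matrix (- X) t"
      using dX by (intro eq_matI) (auto simp: char_matrix_def)
    then show ?thesis
      using char_poly_matrix[OF dN, of t] by simp
  qed
  moreover have "z \<in> \<real>" if "poly (map_poly complex_of_real (char_poly (- X))) z = 0" for z
  proof -
    have "poly (char_poly (map_mat complex_of_real (- X))) z = 0"
      using that dN by (simp add: of_real_hom.char_poly_hom[OF dN])
    then have "eigenvalue (map_mat complex_of_real (- X)) z"
      using eigenvalue_root_char_poly[of "map_mat complex_of_real (- X)" n z] dN by simp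
    then show ?thesis
      by (rule symmetric_eigenvalue_real[OF sX])
  qed
  ultimately show ?thesis
    unfolding real_rooted_def by blast
qed

lemma det_hyperbolic: "hyperbolic n n det (1\<^sub>m n)"
  unfolding hyperbolic_def
  by (auto simp: det_homogeneous_polynomial_on_sym det_real_rooted sym_mats_def)

lemma psd_in_hyperbolicity_cone:
  assumes "psd n A"
  shows "A \<in> hyperbolicity_cone n det (1\<^sub>m n)"
proof -
  have A: "A \<in> sym_mats n" and dA: "A \<in> carrier_mat n n"
    and pos: "\<And>v. v \<in> carrier_vec n \<Longrightarrow> v \<bullet> (A *\<^sub>v v) \<ge> 0"
    using assms by (auto simp: psd_def sym_mats_def)
  have "t \<ge> 0" if t: "det (t \<cdot>\<^sub>m 1\<^sub>m n - A) = 0" for t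
  proof -
    have c: "t \<cdot>\<^sub>m 1\<^sub>m n \<in> carrier_mat n n" "t \<cdot>\<^sub>m 1\<^sub>m n - A \<in> carrier_mat n n"
      using dA by auto
    obtain v where v: "v \<in> carrier_vec n" "v \<noteq> 0\<^sub>v n"
      and "(t \<cdot>\<^sub>m 1\<^sub>m n - A) *\<^sub>v v = 0\<^sub>v n"
      using t det_0_iff_vec_prod_zero_field[OF c(2)] by auto
    moreover have "(t \<cdot>\<^sub>m 1\<^sub>m n) *\<^sub>v v = t \<cdot>\<^sub>v v"
      using v by (intro eq_vecI) auto
    ultimately have "t \<cdot>\<^sub>v v - A *\<^sub>v v = 0\<^sub>v n"
      using minus_mult_distrib_mat_vec[OF c(1) dA v(1)] by simp
    then have "A *\<^sub>v v = t \<cdot>\<^sub>v v"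
      using dA v by (auto simp: vec_eq_iff)
    then have "t * (v \<bullet> v) \<ge> 0"
      using pos[OF v(1)] v by simp
    moreover have "v \<bullet> v > 0"
      using conjugate_square_greater_0_vec[OF v(1)] v by simp
    ultimately show "t \<ge> 0"
      by (simp add: zero_le_mult_iff)
  qed
  then show ?thesis
    using A by (simp add: hyperbolicity_cone_def)
qed

lemma psd_cert_U:
  assumes "psd N Q"
  shows "psd (N + 1) (cert_U N Q)"
proof -
  have Q: "Q \<in> carrier_mat N N" "Q\<^sup>T = Q"
    and pos: "\<And>v. v \<in> carrier_vec N \<Longrightarrow> v \<bullet> (Q *\<^sub>v v) \<ge> 0"
    using assms by (auto simp: psd_def sym_mats_def)
  have "cert_U N Q \<in> sym_mats (N + 1)"
    using Q unfolding sym_mats_def cert_U_def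
    by (auto simp: transpose_four_block_mat[of _ 1 1 _ N _ N])
  moreover have "v \<bullet> (cert_U N Q *\<^sub>v v) \<ge> 0" if v: "v \<in> carrier_vec (N + 1)" for v
  proof -
    define a b where "a = vec_first v 1" and "b = vec_last v N"
    have ab: "a \<in> carrier_vec 1" "b \<in> carrier_vec N" and v_eq: "v = a @\<^sub>v b"
      using v by (auto simp: a_def b_def add.commute)
    have "cert_U N Q *\<^sub>v v = 0\<^sub>v 1 @\<^sub>v (Q *\<^sub>v b)"
      unfolding cert_U_def v_eq
      using Q ab by (subst four_block_mat_mult_vec[of _ 1 1 _ N _ N]) auto
    then have "v \<bullet> (cert_U N Q *\<^sub>v v) = b \<bullet> (Q *\<^sub>v b)"
      using Q ab unfolding v_eq
      by (simp add: scalar_prod_append[of _ 1 _ N])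
    then show ?thesis
      using pos ab by simp
  qed
  ultimately show ?thesis
    by (simp add: psd_def)
qed


section \<open>Uniqueness of the expansion at infinity\<close>

lemma powser_zero_on_right_imp_zero:
  fixes a :: "nat \<Rightarrow> real"
  assumes s: "0 < s"
    and sums0: "\<And>x. 0 < x \<Longrightarrow> x < s \<Longrightarrow> (\<lambda>k. a k * x ^ k) sums 0"
  shows "a n = 0"
proof -
  \<comment> \<open>The constant term is the limit at 0 from the right; higher coefficients follow by dividing
    the series by \<open>x\<close>.\<close>
  have head: "b 0 = 0"
    if b: "\<And>x. 0 < x \<Longrightarrow> x < s \<Longrightarrow> (\<lambda>k. b k * x ^ k) sums 0" for b :: "nat \<Rightarrow> real"
  proof -
    have smb: "(\<lambda>k. b k * x ^ k) sums suminf (\<lambda>k. b k * x ^ k)" if x: "norm x < s" for x :: real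
    proof -
      obtain y where y: "norm x < y" "y < s" using dense[OF x] by blast
      then have "summable (\<lambda>k. b k * y ^ k)"
        using b[of y] norm_ge_zero[of x] by (auto simp: sums_iff)
      then show ?thesis
        using y norm_ge_zero[of x] by (intro summable_sums powser_inside[of b y x]) auto
    qed
    then have "((\<lambda>x. suminf (\<lambda>k. b k * x ^ k)) \<longlongrightarrow> b 0) (at 0)"
      by (intro powser_limit_0[OF s])
    then have lim: "((\<lambda>x. suminf (\<lambda>k. b k * x ^ k)) \<longlongrightarrow> b 0) (at_right 0)"
      by (rule tendsto_within_subset) simp
    have "eventually (\<lambda>x. suminf (\<lambda>k. b k * x ^ k) = 0) (at_right 0)"
      using b s unfolding eventually_at_right_field by (auto simp: sums_iff)
    then have "((\<lambda>x. suminf (\<lambda>k. b k * x ^ k)) \<longlongrightarrow> 0) (at_right 0)"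
      by (rule tendsto_eventually)
    with lim show ?thesis
      by (rule tendsto_unique[rotated]) simp
  qed
  show ?thesis
    using sums0
  proof (induction n arbitrary: a)
    case 0
    then show ?case by (rule head)
  next
    case (Suc n)
    have "(\<lambda>k. a (Suc k) * x ^ k) sums 0" if x: "0 < x" "x < s" for x
    proof -
      have "(\<lambda>k. a (Suc k) * x ^ Suc k) sums 0"
        using Suc.prems[OF x] head[of a] Suc.prems by (subst sums_Suc_iff) simp
      then show ?thesis
        using x sums_mult[of "\<lambda>k. a (Suc k) * x ^ Suc k" 0 "inverse x"]
        by (simp add: field_simps)
    qed
    then show ?case by (rule Suc.IH)
  qed
qed

text \<open>The substitution \<open>x = 1 / t\<close> turns expansions at infinity into power series near 0.\<close>

lemma expansion_at_infinity_unique: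
  fixes h h' :: "nat \<Rightarrow> real"
  assumes "\<forall>\<^sub>F t in at_top. (\<lambda>k. h k / t ^ k) sums f t"
    and "\<forall>\<^sub>F t in at_top. (\<lambda>k. h' k / t ^ k) sums f t"
  shows "h = h'"
proof
  fix n
  have "\<forall>\<^sub>F t in at_top. (\<lambda>k. (h k - h' k) / t ^ k) sums 0"
    using assms
  proof eventually_elim
    case (elim t)
    then show ?case using sums_diff[OF elim] by (simp add: diff_divide_distrib)
  qed
  then obtain T where T: "\<And>t. t \<ge> T \<Longrightarrow> (\<lambda>k. (h k - h' k) / t ^ k) sums 0"
    by (auto simp: eventually_at_top_linorder)
  let ?s = "1 / max T 1"
  have "(\<lambda>k. (h k - h' k) * x ^ k) sums 0" if x: "0 < x" "x < ?s" for x
  proof -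
    have "T * x \<le> max T 1 * x" using x by (intro mult_right_mono) auto
    also have "\<dots> \<le> 1" using x by (simp add: field_simps)
    finally have "1 / x \<ge> T" using x by (simp add: field_simps)
    from T[OF this] show ?thesis by (simp add: power_one_over field_simps)
  qed
  then have "h n - h' n = 0"
    by (intro powser_zero_on_right_imp_zero[of ?s]) auto
  then show "h n = h' n" by simp
qed

lemma hermite_coeffs_eqI:
  assumes "h 0 = 0"
    and "\<forall>\<^sub>F t in at_top.
           (\<lambda>k. h k / t ^ k) sums (dir_deriv p U (X + t \<cdot>\<^sub>m e) / p (X + t \<cdot>\<^sub>m e))"
  shows "hermite_coeffs p e X U = h"
  unfolding hermite_coeffs_def
  using assms by (intro the_equality) (auto intro: expansion_at_infinity_unique)


section \<open>The Hermite coefficients of the determinant\<close>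

text \<open>The trace of a square matrix; only the number of rows enters the definition.\<close>

definition mat_trace :: "'a::comm_monoid_add mat \<Rightarrow> 'a" where
  "mat_trace A = (\<Sum>i<dim_row A. A $$ (i, i))"

lemma mat_trace_mult:
  assumes "A \<in> carrier_mat n m" "B \<in> carrier_mat m n"
  shows "mat_trace (A * B) = (\<Sum>i<n. \<Sum>l<m. A $$ (i, l) * B $$ (l, i))"
  using assms by (auto simp: mat_trace_def scalar_prod_def lessThan_atLeast0)

lemma permutation_fixing_all_but_one:
  assumes "p permutes S" "\<And>j. j \<in> S - {i} \<Longrightarrow> p j = j"
  shows "p = id"
proof
  fix j
  show "p j = id j"
  proof (rule ccontr)
    assume ne: "p j \<noteq> id j"
    then have j: "j \<in> S" using assms(1) by (auto simp: permutes_def)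
    then have pj: "p j \<in> S" using assms(1) by (simp add: permutes_in_image)
    have "p (p j) \<noteq> p j" using ne permutes_inj[OF assms(1)] by (auto dest: injD)
    then have "j = i" "p j = i" using j pj ne assms(2) by auto
    then show False using ne by simp
  qed
qed

text \<open>
  In the derivative of the Leibniz formula at the identity matrix, every summand that belongs to
  a permutation other than the identity contains an off-diagonal entry 0 of the identity matrix:
  such a permutation moves at least two points, and the product rule removes only one factor.
\<close>

lemma det_one_plus_has_derivative:
  fixes M :: "real mat"
  assumes M: "M \<in> carrier_mat n n"
  shows "((\<lambda>s. det (1\<^sub>m n + s \<cdot>\<^sub>m M)) has_real_derivative mat_trace M) (at 0)"
proof -
  let ?\<delta> = "\<lambda>i j. if i = j then 1 else 0 :: real"
  let ?P = "{p. p permutes {0..<n}}"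
  have det_eq: "det (1\<^sub>m n + s \<cdot>\<^sub>m M) =
      (\<Sum>p\<in>?P. signof p * (\<Prod>i\<in>{0..<n}. ?\<delta> i (p i) + s * M $$ (i, p i)))" for s
    using M by (subst det_def'[of _ n]) (auto intro!: sum.cong prod.cong simp: permutes_in_image)
  let ?D = "\<lambda>p. \<Sum>i\<in>{0..<n}. M $$ (i, p i) * (\<Prod>j\<in>{0..<n} - {i}. ?\<delta> j (p j))"
  have "((\<lambda>s. \<Prod>i\<in>{0..<n}. ?\<delta> i (p i) + s * M $$ (i, p i)) has_real_derivative ?D p) (at 0)" for p
    by (rule DERIV_cong, rule has_field_derivative_prod)
       (auto intro!: derivative_eq_intros)
  then have "((\<lambda>s. det (1\<^sub>m n + s \<cdot>\<^sub>m M)) has_real_derivative (\<Sum>p\<in>?P. signof p * ?D p)) (at 0)"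
    unfolding det_eq by (intro DERIV_sum DERIV_cmult)
  also have "(\<Sum>p\<in>?P. signof p * ?D p) = (\<Sum>p\<in>{id}. signof p * ?D p)"
  proof (rule sum.mono_neutral_right)
    show "\<forall>p\<in>?P - {id}. signof p * ?D p = 0"
    proof
      fix p assume "p \<in> ?P - {id}"
      then have p: "p permutes {0..<n}" "p \<noteq> id" by auto
      have "(\<Prod>j\<in>{0..<n} - {i}. ?\<delta> j (p j)) = 0" for i
      proof -
        obtain j where "j \<in> {0..<n} - {i}" "p j \<noteq> j"
          using permutation_fixing_all_but_one[OF p(1)] p(2) by metis
        then show ?thesis by (intro prod_zero) (auto intro!: bexI[of _ j])
      qed
      then show "signof p * ?D p = 0" by (simp only: mult_zero_right sum.neutral_const)
    qed
  qed (auto simp: finite_permutations permutes_id)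
  also have "\<dots> = mat_trace M"
    using M by (simp add: mat_trace_def lessThan_atLeast0)
  finally show ?thesis .
qed

text \<open>Jacobi's formula at an invertible matrix \<open>Y\<close> with inverse \<open>R\<close>.\<close>

lemma dir_deriv_det:
  assumes Y: "Y \<in> carrier_mat n n" and U: "U \<in> carrier_mat n n"
    and R: "R \<in> carrier_mat n n" and RY: "R * Y = 1\<^sub>m n"
  shows "dir_deriv det U Y = det Y * mat_trace (R * U)"
proof -
  have YR: "Y * R = 1\<^sub>m n"
    using mat_mult_left_right_inverse[OF R Y RY] .
  \<comment> \<open>the factorization \<open>Y + s U = Y (1 + s R U)\<close> reduces to the derivative at the identity\<close>
  have "det (Y + s \<cdot>\<^sub>m U) = det Y * det (1\<^sub>m n + s \<cdot>\<^sub>m (R * U))" for s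
  proof -
    have "Y * (1\<^sub>m n + s \<cdot>\<^sub>m (R * U)) = Y + s \<cdot>\<^sub>m (Y * (R * U))"
      using Y U R by (simp add: mult_add_distrib_mat[of _ n n _ n] mult_smult_distrib[of _ n n _ n])
    also have "Y * (R * U) = U"
      using assoc_mult_mat[OF Y R U] YR U by simp
    finally show ?thesis
      using Y U R by (simp flip: det_mult[of _ n])
  qed
  then have "((\<lambda>s. det (Y + s \<cdot>\<^sub>m U)) has_real_derivative det Y * mat_trace (R * U)) (at 0)"
    using det_one_plus_has_derivative[of "R * U" n] U R by (auto intro!: DERIV_cmult)
  then show ?thesis
    unfolding dir_deriv_def by (intro the_equality) (auto intro: DERIV_unique)
qed

lemma pow_mat_entry_bound:
  fixes X :: "real mat"
  assumes X: "X \<in> carrier_mat n n" and i: "i < n" and j: "j < n"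
  shows "\<bar>(X ^\<^sub>m k) $$ (i, j)\<bar> \<le> (\<Sum>a<n. \<Sum>b<n. \<bar>X $$ (a, b)\<bar>) ^ k"
  using j
proof (induction k arbitrary: j)
  case 0
  then show ?case using X i by simp
next
  case (Suc k)
  let ?K = "\<Sum>a<n. \<Sum>b<n. \<bar>X $$ (a, b)\<bar>"
  have K: "?K \<ge> 0" by (simp add: sum_nonneg)
  have Xk: "X ^\<^sub>m k \<in> carrier_mat n n" using X by simp
  have "(X ^\<^sub>m Suc k) $$ (i, j) = (\<Sum>l<n. (X ^\<^sub>m k) $$ (i, l) * X $$ (l, j))"
    using X Xk i Suc.prems by (simp add: scalar_prod_def lessThan_atLeast0)
  also have "\<bar>\<dots>\<bar> \<le> (\<Sum>l<n. \<bar>(X ^\<^sub>m k) $$ (i, l)\<bar> * \<bar>X $$ (l, j)\<bar>)"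
    by (rule order_trans[OF sum_abs]) (simp add: abs_mult)
  also have "\<dots> \<le> (\<Sum>l<n. ?K ^ k * \<bar>X $$ (l, j)\<bar>)"
    using Suc.IH by (intro sum_mono mult_right_mono) auto
  also have "\<dots> = ?K ^ k * (\<Sum>l<n. \<bar>X $$ (l, j)\<bar>)"
    by (simp add: sum_distrib_left)
  also have "\<dots> \<le> ?K ^ k * ?K"
  proof (rule mult_left_mono)
    have "\<bar>X $$ (l, j)\<bar> \<le> (\<Sum>b<n. \<bar>X $$ (l, b)\<bar>)" for l
      using Suc.prems by (intro member_le_sum) auto
    then show "(\<Sum>l<n. \<bar>X $$ (l, j)\<bar>) \<le> ?K" by (rule sum_mono)
  qed (use K in simp)
  finally show ?case by (simp add: mult.commute)
qed

text \<open>
  The series of \<open>(X + t I)\<^sup>-\<^sup>1\<close>, entry by entry: it converges once \<open>t\<close> exceeds the sum of the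
  absolute values of all entries of \<open>X\<close>, and its product with \<open>X + t I\<close> telescopes.
\<close>

lemma resolvent_neumann_series:
  fixes X :: "real mat"
  assumes X: "X \<in> carrier_mat n n"
  shows "\<forall>\<^sub>F t in at_top. \<exists>R\<in>carrier_mat n n. R * (X + t \<cdot>\<^sub>m 1\<^sub>m n) = 1\<^sub>m n \<and>
    (\<forall>i<n. \<forall>j<n. (\<lambda>k. (-1) ^ k * (X ^\<^sub>m k) $$ (i, j) / t ^ Suc k) sums (R $$ (i, j)))"
proof -
  define K where "K = (\<Sum>a<n. \<Sum>b<n. \<bar>X $$ (a, b)\<bar>)"
  have K: "K \<ge> 0" by (simp add: K_def sum_nonneg)
  have "\<exists>R\<in>carrier_mat n n. R * (X + t \<cdot>\<^sub>m 1\<^sub>m n) = 1\<^sub>m n \<and>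
    (\<forall>i<n. \<forall>j<n. (\<lambda>k. (-1) ^ k * (X ^\<^sub>m k) $$ (i, j) / t ^ Suc k) sums (R $$ (i, j)))"
    if t: "t > K" for t
  proof -
    have t0: "t > 0" using t K by simp
    define a where "a i j k = (-1) ^ k * (X ^\<^sub>m k) $$ (i, j) / t ^ k" for i j k
    define R where "R = mat n n (\<lambda>(i, j). suminf (\<lambda>k. a i j k / t))"
    have a_summable: "summable (a i j)" if "i < n" "j < n" for i j
    proof (rule summable_comparison_test')
      show "summable (\<lambda>k. (K / t) ^ k)"
        using t K by (intro summable_geometric) (simp add: field_simps)
      show "norm (a i j k) \<le> (K / t) ^ k" if "k \<ge> 0" for k
        using pow_mat_entry_bound[OF X \<open>i < n\<close> \<open>j < n\<close>, of k] t0
        by (simp add: a_def K_def abs_mult power_abs power_divide divide_right_mono)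
    qed
    have R: "R \<in> carrier_mat n n" by (simp add: R_def)
    have R_sums: "(\<lambda>k. a i j k / t) sums (R $$ (i, j))" if "i < n" "j < n" for i j
      using a_summable[OF that] that by (simp add: R_def summable_sums summable_divide)
    have "R * (X + t \<cdot>\<^sub>m 1\<^sub>m n) = 1\<^sub>m n"
    proof (rule eq_matI)
      fix i j assume ij: "i < dim_row (1\<^sub>m n)" "j < dim_col (1\<^sub>m n)"
      then have i: "i < n" and j: "j < n" by auto
      have "(R * (X + t \<cdot>\<^sub>m 1\<^sub>m n)) $$ (i, j)
          = (\<Sum>l<n. R $$ (i, l) * (X $$ (l, j) + (if l = j then t else 0)))"
        using X R i j by (auto simp: scalar_prod_def lessThan_atLeast0 intro!: sum.cong)
      also have "\<dots> = (\<Sum>l<n. R $$ (i, l) * X $$ (l, j)) + R $$ (i, j) * t"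
        using j by (simp add: distrib_left sum.distrib if_distrib[of "(*) _"] cong: if_cong)
      also have "\<dots> = a i j 0"
      proof (rule sums_unique2)
        show "(\<lambda>k. (\<Sum>l<n. a i l k / t * X $$ (l, j)) + a i j k / t * t) sums
            ((\<Sum>l<n. R $$ (i, l) * X $$ (l, j)) + R $$ (i, j) * t)"
          using R_sums i j by (intro sums_add sums_sum sums_mult2) auto
        have step: "(\<Sum>l<n. a i l k / t * X $$ (l, j)) = - a i j (Suc k)" for k
        proof -
          have "(X ^\<^sub>m Suc k) $$ (i, j) = (\<Sum>l<n. (X ^\<^sub>m k) $$ (i, l) * X $$ (l, j))"
            using X i j by (simp add: scalar_prod_def lessThan_atLeast0)
          then show ?thesis
            by (simp add: a_def sum_distrib_left sum_divide_distrib sum_negf[symmetric] field_simps)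
        qed
        have "(\<lambda>k. a i j k - a i j (Suc k)) sums a i j 0"
          using telescope_sums'[OF summable_LIMSEQ_zero[OF a_summable[OF i j]]] by simp
        moreover have "(\<Sum>l<n. a i l k / t * X $$ (l, j)) + a i j k / t * t
            = a i j k - a i j (Suc k)" for k
          unfolding step using t0 by simp
        ultimately show "(\<lambda>k. (\<Sum>l<n. a i l k / t * X $$ (l, j)) + a i j k / t * t) sums a i j 0"
          by simp
      qed
      also have "\<dots> = 1\<^sub>m n $$ (i, j)"
        using X i j by (simp add: a_def)
      finally show "(R * (X + t \<cdot>\<^sub>m 1\<^sub>m n)) $$ (i, j) = 1\<^sub>m n $$ (i, j)" .
    qed (use X R in auto)
    moreover have "a i j k / t = (-1) ^ k * (X ^\<^sub>m k) $$ (i, j) / t ^ Suc k" for i j k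
      by (simp add: a_def mult.commute)
    ultimately show ?thesis
      using R R_sums by (intro bexI[of _ R]) simp_all
  qed
  then show ?thesis
    by (rule eventually_mono[OF eventually_gt_at_top[of K]])
qed

lemma hermite_coeffs_det:
  assumes X: "X \<in> carrier_mat n n" and U: "U \<in> carrier_mat n n"
  shows "hermite_coeffs det (1\<^sub>m n) X U (Suc k) = (-1) ^ k * mat_trace (X ^\<^sub>m k * U)"
proof -
  define h where "h k = (case k of 0 \<Rightarrow> 0 | Suc j \<Rightarrow> (-1) ^ j * mat_trace (X ^\<^sub>m j * U))" for k
  have "\<forall>\<^sub>F t in at_top.
      (\<lambda>k. h k / t ^ k) sums (dir_deriv det U (X + t \<cdot>\<^sub>m 1\<^sub>m n) / det (X + t \<cdot>\<^sub>m 1\<^sub>m n))"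
    using resolvent_neumann_series[OF X]
  proof eventually_elim
    case (elim t)
    let ?Y = "X + t \<cdot>\<^sub>m 1\<^sub>m n"
    obtain R where R: "R \<in> carrier_mat n n" and RY: "R * ?Y = 1\<^sub>m n"
      and sums: "\<And>i j. i < n \<Longrightarrow> j < n \<Longrightarrow>
        (\<lambda>k. (-1) ^ k * (X ^\<^sub>m k) $$ (i, j) / t ^ Suc k) sums (R $$ (i, j))"
      using elim by blast
    have Y: "?Y \<in> carrier_mat n n" using X by simp
    have "det R * det ?Y = 1"
      using det_mult[OF R Y] RY by simp
    then have "det ?Y \<noteq> 0" by auto
    then have quot: "dir_deriv det U ?Y / det ?Y = mat_trace (R * U)"
      using dir_deriv_det[OF Y U R RY] by simp
    have "(\<lambda>k. \<Sum>i<n. \<Sum>l<n. (-1) ^ k * (X ^\<^sub>m k) $$ (i, l) / t ^ Suc k * U $$ (l, i)) sums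
        (\<Sum>i<n. \<Sum>l<n. R $$ (i, l) * U $$ (l, i))"
      using sums by (intro sums_sum sums_mult2) auto
    moreover have "(\<Sum>i<n. \<Sum>l<n. (-1) ^ k * (X ^\<^sub>m k) $$ (i, l) / t ^ Suc k * U $$ (l, i))
        = h (Suc k) / t ^ Suc k" for k
      using X U
      by (simp add: h_def mat_trace_mult[of _ n n] sum_distrib_left sum_divide_distrib mult.assoc)
    ultimately have "(\<lambda>k. h (Suc k) / t ^ Suc k) sums mat_trace (R * U)"
      using mat_trace_mult[OF R U] by simp
    then have "(\<lambda>k. h k / t ^ k) sums mat_trace (R * U)"
      using sums_Suc_iff[of "\<lambda>k. h k / t ^ k" "mat_trace (R * U)"] by (simp add: h_def)
    then show ?case
      by (simp add: quot)
  qed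
  then have "hermite_coeffs det (1\<^sub>m n) X U = h"
    by (intro hermite_coeffs_eqI) (simp_all add: h_def)
  then show ?thesis
    by (simp add: h_def)
qed


section \<open>The certificate\<close>

text \<open>Indices start at 0, so the diagonal entry with index \<open>i\<close> is the coefficient \<open>h\<^sub>2\<^sub>i\<^sub>+\<^sub>1\<close>.\<close>

lemma hermite_form_unit_vec:
  assumes "i < D"
  shows "hermite_form D p e X (unit_vec D i) U = hermite_coeffs p e X U (2 * i + 1)"
proof -
  let ?H = "hermite_mat D p e X U"
  have H: "?H \<in> carrier_mat D D" by (simp add: hermite_mat_def)
  have "?H *\<^sub>v unit_vec D i = col ?H i"
    using H assms by (intro eq_vecI) auto
  then have "hermite_form D p e X (unit_vec D i) U = ?H $$ (i, i)"
    using H assms by (simp add: hermite_form_def scalar_prod_left_unit[of _ D])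
  then show ?thesis
    using assms by (simp add: hermite_mat_def mult_2)
qed

lemma trace_cert:
  fixes \<mu> :: "nat \<Rightarrow> nat mono" and x :: "real vec"
  assumes Q: "Q \<in> carrier_mat N N"
  defines "w \<equiv> monomial_vec N \<mu> x"
  shows "mat_trace (cert_F N \<mu> x ^\<^sub>m 2 * cert_U N Q) = w \<bullet> (Q *\<^sub>v w)"
proof -
  define r c where "r = mat_of_rows N [w]" and "c = mat_of_cols N [w]"
  have w: "w \<in> carrier_vec N" by (simp add: w_def monomial_vec_def)
  have r: "r \<in> carrier_mat 1 N" and c: "c \<in> carrier_mat N 1"
    by (simp_all add: r_def c_def mat_of_rows_def mat_of_cols_def)
  have cr: "c * r \<in> carrier_mat N N" using r c by simp
  have F: "cert_F N \<mu> x = four_block_mat (0\<^sub>m 1 1) r c (0\<^sub>m N N)"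
    by (simp add: cert_F_def r_def c_def w_def)
  have F_carrier: "cert_F N \<mu> x \<in> carrier_mat (1 + N) (1 + N)"
    unfolding F by (intro four_block_carrier_mat) auto
  have "cert_F N \<mu> x ^\<^sub>m 2 = cert_F N \<mu> x * cert_F N \<mu> x"
    using F_carrier by (simp add: numeral_2_eq_2)
  also have "\<dots> = four_block_mat (r * c) (0\<^sub>m 1 N) (0\<^sub>m N 1) (c * r)"
    unfolding F using r c
    by (subst mult_four_block_mat[of _ 1 1 _ N _ N _ _ 1 _ N]) auto
  finally have "cert_F N \<mu> x ^\<^sub>m 2 * cert_U N Q
      = four_block_mat (r * c) (0\<^sub>m 1 N) (0\<^sub>m N 1) (c * r) * cert_U N Q"
    by simp
  also have "\<dots> = four_block_mat (0\<^sub>m 1 1) (0\<^sub>m 1 N) (0\<^sub>m N 1) (c * r * Q)"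
    unfolding cert_U_def using r c cr Q
    by (subst mult_four_block_mat[of _ 1 1 _ N _ N _ _ 1 _ N]) auto
  finally have "mat_trace (cert_F N \<mu> x ^\<^sub>m 2 * cert_U N Q) = mat_trace (c * r * Q)"
    using c Q by (simp add: mat_trace_def sum.lessThan_Suc_shift del: sum.lessThan_Suc)
  also have "\<dots> = (\<Sum>i<N. \<Sum>l<N. w $ i * w $ l * Q $$ (l, i))"
  proof -
    have "(c * r) $$ (i, l) = w $ i * w $ l" if "i < N" "l < N" for i l
      using that by (simp add: c_def r_def mat_of_rows_def mat_of_cols_def scalar_prod_def)
    then show ?thesis
      using mat_trace_mult[OF cr Q] by simp
  qed
  also have "\<dots> = (\<Sum>l<N. \<Sum>i<N. w $ i * w $ l * Q $$ (l, i))"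
    by (rule sum.swap)
  also have "\<dots> = w \<bullet> (Q *\<^sub>v w)"
    using w Q
    by (auto simp: scalar_prod_def lessThan_atLeast0 sum_distrib_left mult_ac intro!: sum.cong)
  finally show ?thesis .
qed

lemma polynomial_fun_const: "polynomial_fun m (\<lambda>z. c)"
  unfolding polynomial_fun_def
  by (rule bexI[of _ "Poly_Mapping.single 0 c"]) (auto simp: rpolys_in_def split: if_splits)

lemma polynomial_fun_mono_eval:
  assumes "Poly_Mapping.keys \<alpha> \<subseteq> {..<m}"
  shows "polynomial_fun m (\<lambda>z. mono_eval \<alpha> (\<lambda>v. z $ v))"
  unfolding polynomial_fun_def
  by (rule bexI[of _ "Poly_Mapping.single \<alpha> 1"]) (use assms in \<open>auto simp: rpolys_in_def\<close>)

lemma polynomial_map_cert_F: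
  assumes "\<And>i. i < N \<Longrightarrow> Poly_Mapping.keys (\<mu> i) \<subseteq> {..<m}"
  shows "polynomial_map_sym m (N + 1) (cert_F N \<mu>)"
  unfolding polynomial_map_sym_def
proof (intro conjI ballI allI impI)
  fix z :: "real vec"
  show "cert_F N \<mu> z \<in> sym_mats (N + 1)"
    unfolding sym_mats_def cert_F_def
    by (simp, subst transpose_four_block_mat[of _ 1 1 _ N _ N])
       (auto simp: transpose_mat_of_rows transpose_mat_of_cols mat_of_rows_def mat_of_cols_def)
next
  fix i j assume ij: "i < N + 1" "j < N + 1"
  have entry: "cert_F N \<mu> z $$ (i, j) =
      (if i = 0 \<and> j \<noteq> 0 then mono_eval (\<mu> (j - 1)) (\<lambda>v. z $ v)
       else if i \<noteq> 0 \<and> j = 0 then mono_eval (\<mu> (i - 1)) (\<lambda>v. z $ v) else 0)" for z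
    using ij by (auto simp: cert_F_def monomial_vec_def mat_of_rows_def mat_of_cols_def)
  have "polynomial_fun m (\<lambda>z. if i = 0 \<and> j \<noteq> 0 then mono_eval (\<mu> (j - 1)) (\<lambda>v. z $ v)
       else if i \<noteq> 0 \<and> j = 0 then mono_eval (\<mu> (i - 1)) (\<lambda>v. z $ v) else 0)"
  proof -
    have "polynomial_fun m (\<lambda>z. mono_eval (\<mu> (k - 1)) (\<lambda>v. z $ v))"
      if "k < N + 1" "k \<noteq> 0" for k
      using that by (intro polynomial_fun_mono_eval assms) auto
    then show ?thesis
      using ij by (cases "i = 0"; cases "j = 0") (simp_all add: polynomial_fun_const)
  qed
  then show "polynomial_fun m (\<lambda>z. cert_F N \<mu> z $$ (i, j))"
    unfolding entry .
qed

theorem proposition3p13: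
  fixes m d N :: nat
    and q :: "nat rpoly"
    and \<mu> :: "nat \<Rightarrow> nat mono"
    and Q :: "real mat"
  assumes "m \<ge> 1"
    and "q \<in> rpolys_in {..<m}"
    and "homogeneous (2 * d) q"
    and "sum_of_squares m q"
    and "N = (m + d - 1) choose d"
    and "bij_betw \<mu> {..<N} (monomials m d)"
    and "psd N Q"
    and "\<forall>x\<in>carrier_vec m.
           rpoly_eval q (\<lambda>v. x $ v) = monomial_vec N \<mu> x \<bullet> (Q *\<^sub>v monomial_vec N \<mu> x)"
  shows "hyperbolic (N + 1) (N + 1) det (1\<^sub>m (N + 1))
    \<and> hyperbolic_certificate (N + 1) (N + 1) det (1\<^sub>m (N + 1)) m q
         (cert_U N Q) (cert_F N \<mu>) (\<lambda>x. unit_vec (N + 1) 1)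
    \<and> has_hyperbolic_certificate (N + 1) (N + 1) det (1\<^sub>m (N + 1)) m q"
proof -
  let ?n = "N + 1"
  have Q: "Q \<in> carrier_mat N N"
    using \<open>psd N Q\<close> by (simp add: psd_def sym_mats_def)
  \<comment> \<open>so that \<open>1\<close>, the index of the second basis vector when counting from 0, is below \<open>N + 1\<close>\<close>
  have "N \<ge> 1"
    using \<open>m \<ge> 1\<close> \<open>N = (m + d - 1) choose d\<close> zero_less_binomial[of d "m + d - 1"] by linarith
  have cert: "hyperbolic_certificate ?n ?n det (1\<^sub>m ?n) m q
      (cert_U N Q) (cert_F N \<mu>) (\<lambda>x. unit_vec ?n 1)"
    unfolding hyperbolic_certificate_def
  proof (intro conjI ballI)
    show "cert_U N Q \<in> hyperbolicity_cone ?n det (1\<^sub>m ?n)"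
      using psd_in_hyperbolicity_cone psd_cert_U \<open>psd N Q\<close> by blast
    show F: "polynomial_map_sym m ?n (cert_F N \<mu>)"
    proof (rule polynomial_map_cert_F)
      fix i assume "i < N"
      then have "\<mu> i \<in> monomials m d"
        using \<open>bij_betw \<mu> {..<N} (monomials m d)\<close> by (auto simp: bij_betw_def)
      then show "Poly_Mapping.keys (\<mu> i) \<subseteq> {..<m}"
        by (simp add: monomials_def)
    qed
    show "polynomial_map_vec m ?n (\<lambda>x. unit_vec ?n 1)"
      unfolding polynomial_map_vec_def by (auto intro: polynomial_fun_const)
    fix z :: "real vec" assume z: "z \<in> carrier_vec m"
    have Fz: "cert_F N \<mu> z \<in> carrier_mat ?n ?n"
      using F z by (simp add: polynomial_map_sym_def sym_mats_def)
    have Uc: "cert_U N Q \<in> carrier_mat ?n ?n"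
      using psd_cert_U[OF \<open>psd N Q\<close>] by (simp add: psd_def sym_mats_def)
    have "hermite_form ?n det (1\<^sub>m ?n) (cert_F N \<mu> z) (unit_vec ?n 1) (cert_U N Q)
        = hermite_coeffs det (1\<^sub>m ?n) (cert_F N \<mu> z) (cert_U N Q) (Suc 2)"
      using \<open>N \<ge> 1\<close> by (subst hermite_form_unit_vec) simp_all
    also have "\<dots> = mat_trace (cert_F N \<mu> z ^\<^sub>m 2 * cert_U N Q)"
      using hermite_coeffs_det[OF Fz Uc, of 2] by simp
    also have "\<dots> = monomial_vec N \<mu> z \<bullet> (Q *\<^sub>v monomial_vec N \<mu> z)"
      by (rule trace_cert[OF Q])
    also have "\<dots> = rpoly_eval q (\<lambda>v. z $ v)"
      using assms(8) z by simp
    finally show "rpoly_eval q (\<lambda>v. z $ v) =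
        hermite_form ?n det (1\<^sub>m ?n) (cert_F N \<mu> z) (unit_vec ?n 1) (cert_U N Q)"
      by simp
  qed
  then show ?thesis
    using det_hyperbolic unfolding has_hyperbolic_certificate_def by blast
qed

end
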